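(* Let $p$ be an odd prime, let $e>0$ be a positive integer, and let $n=2p^e$. Let $G=\operatorname{Hol}(C_n)$ be the holomorph of the cyclic group $C_n$ of order $n$. Then there exists a group isomorphism $G\cong \operatorname{Aut}(G)$.
   Context: $C_n$ denotes the cyclic group of order $n$. For a group $A$, the holomorph of $A$ is the semi-direct product $\operatorname{Hol}(A)=A\rtimes \operatorname{Aut}(A)$ with respect to the identity map $\operatorname{Aut}(A)\to\operatorname{Aut}(A)$; that is, the set $A\times\operatorname{Aut}(A)$ with multiplication $(a_1,b_1)\cdot(a_2,b_2)=(a_1\,b_1(a_2),\,b_1b_2)$. $\operatorname{Aut}(G)$ denotes the group of automorphisms of $G$ under composition. *)

theory Defs
  imports
    "HOL-Algebra.Bij"
    "HOL-Algebra.Elementary_Groups"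
    "HOL-Computational_Algebra.Primes"
begin

text \<open>The action \<open>\<phi>\<close> is meant to be a homomorphism from \<open>B\<close> to \<open>AutoGroup A\<close>;
  the lemma \<open>group_semidirect_product\<close> assumes this.\<close>

definition semidirect_product ::
  "('a, 'c) monoid_scheme \<Rightarrow> ('b, 'd) monoid_scheme \<Rightarrow> ('b \<Rightarrow> 'a \<Rightarrow> 'a) \<Rightarrow> ('a \<times> 'b) monoid"
  where "semidirect_product A B \<phi> =
    \<lparr>carrier = carrier A \<times> carrier B,
     monoid.mult = \<lambda>(a1, b1) (a2, b2). (a1 \<otimes>\<^bsub>A\<^esub> \<phi> b1 a2, b1 \<otimes>\<^bsub>B\<^esub> b2),
     one = (\<one>\<^bsub>A\<^esub>, \<one>\<^bsub>B\<^esub>)\<rparr>"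

lemma group_semidirect_product:
  assumes A: "group A" and B: "group B" and \<phi>: "\<phi> \<in> hom B (AutoGroup A)"
  shows "group (semidirect_product A B \<phi>)"
proof -
  interpret A: group A by (rule A)
  interpret B: group B by (rule B)
  interpret \<phi>: group_hom B "AutoGroup A" \<phi>
    by (intro group_hom.intro group_hom_axioms.intro B A.AutoGroup \<phi>)
  have aut: "\<phi> b \<in> auto A" if "b \<in> carrier B" for b
    using \<phi>.hom_closed[OF that] by (simp add: AutoGroup_def)
  have cl: "\<phi> b a \<in> carrier A" if "b \<in> carrier B" "a \<in> carrier A" for a b
    using aut[OF that(1)] that(2) by (auto simp: auto_def hom_def)
  have dist: "\<phi> b (a \<otimes>\<^bsub>A\<^esub> a') = \<phi> b a \<otimes>\<^bsub>A\<^esub> \<phi> b a'"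
    if "b \<in> carrier B" "a \<in> carrier A" "a' \<in> carrier A" for a a' b
    using aut[OF that(1)] that by (auto simp: auto_def hom_def)
  have comp: "\<phi> (b \<otimes>\<^bsub>B\<^esub> b') a = \<phi> b (\<phi> b' a)"
    if "b \<in> carrier B" "b' \<in> carrier B" "a \<in> carrier A" for a b b'
    using \<phi>.hom_mult[OF that(1,2)] aut[OF that(1)] aut[OF that(2)] that(3)
    by (auto simp: AutoGroup_def BijGroup_def auto_def compose_def)
  have one: "\<phi> \<one>\<^bsub>B\<^esub> a = a" if "a \<in> carrier A" for a
    using \<phi>.hom_one that by (simp add: AutoGroup_def BijGroup_def)
  show ?thesis
  proof (rule groupI)
    fix x assume "x \<in> carrier (semidirect_product A B \<phi>)"
    then obtain a b where x: "x = (a, b)" "a \<in> carrier A" "b \<in> carrier B"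
      by (auto simp: semidirect_product_def)
    let ?y = "(\<phi> (inv\<^bsub>B\<^esub> b) (inv\<^bsub>A\<^esub> a), inv\<^bsub>B\<^esub> b)"
    have "\<phi> (inv\<^bsub>B\<^esub> b) (inv\<^bsub>A\<^esub> a) \<otimes>\<^bsub>A\<^esub> \<phi> (inv\<^bsub>B\<^esub> b) a = \<phi> (inv\<^bsub>B\<^esub> b) \<one>\<^bsub>A\<^esub>"
      using x dist[of "inv\<^bsub>B\<^esub> b" "inv\<^bsub>A\<^esub> a" a] by simp
    also have "\<dots> = \<one>\<^bsub>A\<^esub>"
      using x dist[of "inv\<^bsub>B\<^esub> b" "\<one>\<^bsub>A\<^esub>" "\<one>\<^bsub>A\<^esub>"] cl[of "inv\<^bsub>B\<^esub> b" "\<one>\<^bsub>A\<^esub>"] A.l_cancel_one by simp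
    finally show "\<exists>y \<in> carrier (semidirect_product A B \<phi>).
        y \<otimes>\<^bsub>semidirect_product A B \<phi>\<^esub> x = \<one>\<^bsub>semidirect_product A B \<phi>\<^esub>"
      using x cl[of "inv\<^bsub>B\<^esub> b" "inv\<^bsub>A\<^esub> a"] by (intro bexI[of _ ?y]) (auto simp: semidirect_product_def)
  qed (auto simp: semidirect_product_def cl dist comp one A.m_assoc B.m_assoc simp del: \<phi>.hom_mult \<phi>.hom_one)
qed

text \<open>The elements of \<open>AutoGroup A\<close> are extensional functions, so each automorphism
  of \<open>A\<close> occurs exactly once as a second component.\<close>

definition holomorph :: "('a, 'c) monoid_scheme \<Rightarrow> ('a \<times> ('a \<Rightarrow> 'a)) monoid"
  where "holomorph A = semidirect_product A (AutoGroup A) (\<lambda>b. b)"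

lemma group_holomorph:
  assumes "group A"
  shows "group (holomorph A)"
  unfolding holomorph_def
  using assms by (intro group_semidirect_product group.AutoGroup) (auto simp: hom_def)

end

theory Submission
  imports Defs "HOL-Algebra.Multiplicative_Group" "HOL-Number_Theory.Residue_Primitive_Roots"
begin

text \<open>
  Let \<open>C\<close> be cyclic of order \<open>n = 2 p\<^sup>e\<close>. Its automorphism group is cyclic, generated by
  \<open>\<gamma> x = x\<^sup>g\<close> for a primitive root \<open>g\<close> modulo \<open>n\<close>. The geometric sums
  \<open>s (\<gamma>\<^sup>k) = 1 + g + \<dots> + g\<^bsup>k-1\<^esup>\<close> are well defined modulo \<open>n\<close>, since the sum over a full period
  vanishes modulo \<open>p\<^sup>e\<close> (as \<open>g - 1\<close> is a unit there) and modulo \<open>2\<close> (an even number of odd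
  terms). They form a crossed homomorphism, so that
  \<open>\<Phi> (b, \<beta>) (x, \<alpha>) = (\<beta> x \<cdot> b\<^bsup>s \<alpha>\<^esup>, \<alpha>)\<close> is an injective homomorphism from \<open>Hol C\<close> to
  \<open>Aut (Hol C)\<close>. Conversely, every automorphism \<open>f\<close> of \<open>Hol C\<close> preserves the normal subgroup
  \<open>C\<close>; comparing the conjugation action of \<open>\<gamma>\<close> and of \<open>f \<gamma>\<close> on the cyclic group \<open>C\<close> gives
  \<open>f (1, \<gamma>) = (b, \<gamma>)\<close> for some \<open>b\<close>, and then \<open>f = \<Phi> (b, \<beta>)\<close> with \<open>\<beta>\<close> the restriction of \<open>f\<close>
  to \<open>C\<close>. (\<open>Hol C\<close> has a centre of order two, so \<open>\<Phi>\<close> is not conjugation.)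
\<close>

section \<open>Primitive roots modulo 2 p^e and their geometric sums\<close>

text \<open>The last property lets a geometric sum depend only on the power \<open>g ^ k\<close>,
  hence only on the automorphism x -> x^(g^k), and not on the exponent \<open>k\<close>. Exponents
  giving equal powers differ by a multiple \<open>d\<close> of \<open>totient n\<close>, and the sum
  over \<open>d\<close> terms vanishes modulo \<open>n\<close>.\<close>

lemma primroot_geometric_sums:
  fixes p e n :: nat
  assumes p: "prime p" "odd p" and e: "e > 0" and n: "n = 2 * p ^ e"
  obtains g where "coprime g n" "\<And>m. coprime m n \<Longrightarrow> \<exists>k. [g ^ k = m] (mod n)"
    "\<And>k l. [g ^ k = g ^ l] (mod n) \<Longrightarrow> [(\<Sum>i<k. g ^ i) = (\<Sum>i<l. g ^ i)] (mod n)"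
proof -
  have p3: "p \<ge> 3"
    using p prime_ge_2_nat[of p] by (cases "p = 2") auto
  have "p ^ e \<ge> p ^ 1"
    using p3 e by (intro power_increasing) auto
  then have n2: "n > 2"
    using p3 n by simp
  have "n \<in> cyclic_moduli"
    using p e n unfolding cyclic_moduli_def by auto
  then obtain g where g: "residue_primroot n g"
    using residue_primroot_iff_in_cyclic_moduli by blast
  have cop: "coprime g n" and ord: "ord n g = totient n"
    using g by (auto simp: residue_primroot_def coprime_commute)
  have gen: "\<exists>k. [g ^ k = m] (mod n)" if m: "coprime m n" for m
  proof -
    have "coprime (m mod n) n"
      using m n2 by simp
    moreover have "m mod n \<noteq> 0"
      using calculation n2 by (intro notI) simp
    ultimately have "m mod n \<in> totatives n"
      using n2 by (auto simp: totatives_def intro: less_imp_le)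
    moreover have "bij_betw (\<lambda>i. g ^ i mod n) {..<totient n} (totatives n)"
      using residue_primroot_is_generator[OF _ g] n2 by simp
    ultimately obtain k where "m mod n = g ^ k mod n"
      unfolding bij_betw_def by blast
    then show ?thesis
      by (auto simp: cong_def)
  qed
  have g_odd: "odd g"
    using cop n e by (auto simp: coprime_mult_right_iff)
  \<comment> \<open>Otherwise all powers of \<open>g\<close> would be 1 modulo \<open>p\<close>; but
    the unit \<open>n - 1\<close>, that is -1, is such a power, so -1 = 1 modulo \<open>p\<close>,
    which is impossible for odd \<open>p\<close>.\<close>
  have g_not_1: "\<not> [g = 1] (mod p)"
  proof
    assume g1: "[g = 1] (mod p)"
    have "coprime (n - 1) n"
      using n2 by (intro coprime_diff_one_left_nat) auto
    then obtain k where "[g ^ k = n - 1] (mod n)"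
      using gen by blast
    moreover have pn: "p dvd n"
      using n e by simp
    ultimately have "[g ^ k = n - 1] (mod p)"
      using cong_dvd_modulus_nat by blast
    moreover have "[g ^ k = 1] (mod p)"
      using cong_pow[OF g1, of k] by simp
    ultimately have "[n - 1 + 1 = 1 + 1] (mod p)"
      by (intro cong_add) (auto intro: cong_trans cong_sym)
    then have "[n = 2] (mod p)"
      using n2 by (simp add: numeral_2_eq_2)
    then have "p dvd 2"
      using pn cong_dvd_iff by blast
    then show False
      using p3 by (auto dest: dvd_imp_le)
  qed
  have g1: "g \<ge> 1"
    using g_odd by (cases g) auto
  have "\<not> p dvd g - 1"
    using g_not_1 g1 by (simp add: cong_altdef_nat)
  then have cop_pe: "coprime (p ^ e) (g - 1)"
    using p by (simp add: prime_imp_coprime)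
  \<comment> \<open>The two sums differ by \<open>g ^ l\<close> times the sum over \<open>d\<close>
    terms. Divisibility of the latter by \<open>n\<close> is checked on the coprime factors 2 and
    \<open>p ^ e\<close>.\<close>
  have step: "[(\<Sum>i<l + d. g ^ i) = (\<Sum>i<l. g ^ i)] (mod n)" if "[g ^ (l + d) = g ^ l] (mod n)" for l d
  proof -
    have "[g ^ l * g ^ d = g ^ l * 1] (mod n)"
      using that by (simp add: power_add)
    then have gd: "[g ^ d = 1] (mod n)"
      using cop by (subst (asm) cong_mult_lcancel_nat) auto
    then have "totient n dvd d"
      using ord_divides[of g d n] ord by simp
    then have "even d"
      using totient_even[of n] n2 by auto
    \<comment> \<open>An even number of odd terms: \<open>totient n\<close> is even for
      \<open>n > 2\<close> and divides \<open>d\<close>.\<close>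
    then have "even (\<Sum>i<d. g ^ i)"
      using g_odd by (simp add: even_sum_iff)
    moreover have "p ^ e dvd (\<Sum>i<d. g ^ i)"
    proof -
      have "n dvd g ^ d - 1"
        using gd g1 by (simp add: cong_altdef_nat)
      then have "p ^ e dvd g ^ d - 1"
        using n dvd_trans by fastforce
      \<comment> \<open>Since \<open>p ^ e\<close> is coprime to \<open>g - 1\<close>, it must
        divide the sum. The factorisation is taken over the integers, away from truncated
        subtraction.\<close>
      also have "g ^ d - 1 = (g - 1) * (\<Sum>i<d. g ^ i)"
      proof -
        have "int (g ^ d - 1) = int ((g - 1) * (\<Sum>i<d. g ^ i))"
          using g1 power_diff_1_eq[of "int g" d] by (simp add: of_nat_diff)
        then show ?thesis
          by (simp only: of_nat_eq_iff)
      qed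
      finally show ?thesis
        using cop_pe by (simp add: coprime_dvd_mult_right_iff)
    qed
    moreover have "coprime 2 (p ^ e)"
      using p by simp
    ultimately have "n dvd (\<Sum>i<d. g ^ i)"
      unfolding n by (intro divides_mult)
    then have "[(\<Sum>i<l. g ^ i) + g ^ l * (\<Sum>i<d. g ^ i) = (\<Sum>i<l. g ^ i) + 0] (mod n)"
      by (intro cong_add) (auto simp: cong_0_iff)
    moreover have "(\<Sum>i<l + d. g ^ i) = (\<Sum>i<l. g ^ i) + g ^ l * (\<Sum>i<d. g ^ i)"
      by (induction d) (auto simp: algebra_simps power_add)
    ultimately show ?thesis
      by simp
  qed
  have "[(\<Sum>i<k. g ^ i) = (\<Sum>i<l. g ^ i)] (mod n)" if "[g ^ k = g ^ l] (mod n)" for k l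
  proof (cases "l \<le> k")
    case True
    then show ?thesis
      using step[of l "k - l"] that by simp
  next
    case False
    then show ?thesis
      using step[of k "l - k"] that by (simp add: cong_sym)
  qed
  with cop gen show thesis
    by (rule that)
qed

section \<open>Calculation rules for automorphism groups and holomorphs\<close>

lemma carrier_AutoGroup [simp]: "carrier (AutoGroup G) = auto G"
  by (simp add: AutoGroup_def)

lemma one_AutoGroup: "\<one>\<^bsub>AutoGroup G\<^esub> = (\<lambda>x\<in>carrier G. x)"
  by (simp add: AutoGroup_def BijGroup_def)

lemma mult_AutoGroup:
  assumes "\<alpha> \<in> auto G" "\<beta> \<in> auto G"
  shows "\<alpha> \<otimes>\<^bsub>AutoGroup G\<^esub> \<beta> = compose (carrier G) \<alpha> \<beta>"
  using assms by (simp add: AutoGroup_def BijGroup_def auto_def)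

lemma AutoGroup_apply [simp]:
  assumes "x \<in> carrier G"
  shows "\<one>\<^bsub>AutoGroup G\<^esub> x = x"
    and "\<alpha> \<in> auto G \<Longrightarrow> \<beta> \<in> auto G \<Longrightarrow> (\<alpha> \<otimes>\<^bsub>AutoGroup G\<^esub> \<beta>) x = \<alpha> (\<beta> x)"
  using assms by (simp_all add: one_AutoGroup mult_AutoGroup compose_eq)

lemma auto_mult:
  "\<alpha> \<in> auto G \<Longrightarrow> x \<in> carrier G \<Longrightarrow> y \<in> carrier G \<Longrightarrow> \<alpha> (x \<otimes>\<^bsub>G\<^esub> y) = \<alpha> x \<otimes>\<^bsub>G\<^esub> \<alpha> y"
  by (auto simp: auto_def hom_def)

lemma auto_bij: "\<alpha> \<in> auto G \<Longrightarrow> bij_betw \<alpha> (carrier G) (carrier G)"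
  by (auto simp: auto_def Bij_def)

lemma auto_eqI:
  assumes "\<alpha> \<in> auto G" "\<beta> \<in> auto G" "\<And>x. x \<in> carrier G \<Longrightarrow> \<alpha> x = \<beta> x"
  shows "\<alpha> = \<beta>"
proof (rule extensionalityI)
  show "\<alpha> \<in> extensional (carrier G)" "\<beta> \<in> extensional (carrier G)"
    using assms(1,2) by (simp_all add: auto_def Bij_def)
qed (rule assms)

text \<open>The restriction is there because \<open>auto G\<close> contains only functions that are
  extensional on the carrier.\<close>

lemma restrict_in_autoI:
  assumes "bij_betw h (carrier G) (carrier G)"
    and "\<And>x y. x \<in> carrier G \<Longrightarrow> y \<in> carrier G \<Longrightarrow> h (x \<otimes>\<^bsub>G\<^esub> y) = h x \<otimes>\<^bsub>G\<^esub> h y"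
    and "group G"
  shows "restrict h (carrier G) \<in> auto G"
proof -
  interpret group G by fact
  have "h \<in> carrier G \<rightarrow> carrier G"
    by (rule bij_betw_imp_funcset) (rule assms)
  then have "restrict h (carrier G) \<in> hom G G"
    using assms(2) by (intro homI) auto
  moreover have "restrict h (carrier G) \<in> Bij (carrier G)"
    using assms(1) by (simp add: Bij_def cong: bij_betw_cong)
  ultimately show ?thesis
    by (simp add: auto_def)
qed

lemma auto_closed [simp]: "\<alpha> \<in> auto G \<Longrightarrow> x \<in> carrier G \<Longrightarrow> \<alpha> x \<in> carrier G"
  by (auto simp: auto_def hom_def)

lemma (in group) auto_group_hom: "\<alpha> \<in> auto G \<Longrightarrow> group_hom G G \<alpha>"
  by (intro group_hom.intro group_hom_axioms.intro is_group) (auto simp: auto_def)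

lemma holomorph_simps [simp]:
  "carrier (holomorph G) = carrier G \<times> auto G"
  "(a, \<alpha>) \<otimes>\<^bsub>holomorph G\<^esub> (b, \<beta>) = (a \<otimes>\<^bsub>G\<^esub> \<alpha> b, \<alpha> \<otimes>\<^bsub>AutoGroup G\<^esub> \<beta>)"
  "\<one>\<^bsub>holomorph G\<^esub> = (\<one>\<^bsub>G\<^esub>, \<one>\<^bsub>AutoGroup G\<^esub>)"
  by (simp_all add: holomorph_def semidirect_product_def)

section \<open>The isomorphism obtained from a crossed homomorphism\<close>

text \<open>Here \<open>s_mult\<close> is the crossed homomorphism law, phrased on powers of
  elements so that no modulus appears, and \<open>char\<close> expresses that every automorphism of
  the holomorph maps the normal subgroup \<open>G\<close> into itself.\<close>

theorem (in comm_group) holomorph_iso_AutoGroup_holomorph: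
  fixes s :: "('a \<Rightarrow> 'a) \<Rightarrow> nat"
  assumes fin: "finite (carrier G)"
    and \<gamma>: "\<gamma> \<in> auto G"
    and gen: "\<And>\<alpha>. \<alpha> \<in> auto G \<Longrightarrow> \<exists>k::nat. \<alpha> = \<gamma> [^]\<^bsub>AutoGroup G\<^esub> k"
    and s_mult: "\<And>\<alpha> \<beta> x. \<alpha> \<in> auto G \<Longrightarrow> \<beta> \<in> auto G \<Longrightarrow> x \<in> carrier G \<Longrightarrow>
      x [^] s (\<alpha> \<otimes>\<^bsub>AutoGroup G\<^esub> \<beta>) = x [^] s \<alpha> \<otimes> \<alpha> (x [^] s \<beta>)"
    and s_\<gamma>: "\<And>x. x \<in> carrier G \<Longrightarrow> x [^] s \<gamma> = x"
    and char: "\<And>f x. f \<in> auto (holomorph G) \<Longrightarrow> x \<in> carrier G \<Longrightarrow>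
      snd (f (x, \<one>\<^bsub>AutoGroup G\<^esub>)) = \<one>\<^bsub>AutoGroup G\<^esub>"
  shows "holomorph G \<cong> AutoGroup (holomorph G)"
proof -
  let ?A = "AutoGroup G" and ?H = "holomorph G"
  interpret A: group ?A by (rule AutoGroup)
  interpret H: group ?H by (rule group_holomorph) (rule is_group)
  have one_auto [simp]: "\<one>\<^bsub>?A\<^esub> \<in> auto G"
    using A.one_closed by simp
  have mult_auto [simp]: "\<alpha> \<otimes>\<^bsub>?A\<^esub> \<beta> \<in> auto G" if "\<alpha> \<in> auto G" "\<beta> \<in> auto G" for \<alpha> \<beta>
    using A.m_closed that by simp
  have A_one [simp]: "\<alpha> \<otimes>\<^bsub>?A\<^esub> \<one>\<^bsub>?A\<^esub> = \<alpha>" "\<one>\<^bsub>?A\<^esub> \<otimes>\<^bsub>?A\<^esub> \<alpha> = \<alpha>" if "\<alpha> \<in> auto G" for \<alpha>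
    using that by simp_all
  have auto_one [simp]: "\<alpha> \<one> = \<one>" if "\<alpha> \<in> auto G" for \<alpha>
    using group_hom.hom_one[OF auto_group_hom[OF that]] .
  have auto_pow: "\<alpha> (x [^] k) = \<alpha> x [^] k" if "\<alpha> \<in> auto G" "x \<in> carrier G" for \<alpha> x and k :: nat
    using group_hom.hom_nat_pow[OF auto_group_hom[OF that(1)] that(2)] .
  have A_comm: "\<alpha> \<otimes>\<^bsub>?A\<^esub> \<beta> = \<beta> \<otimes>\<^bsub>?A\<^esub> \<alpha>" if "\<alpha> \<in> auto G" "\<beta> \<in> auto G" for \<alpha> \<beta>
    using gen[OF that(1)] gen[OF that(2)] \<gamma> by (auto simp: A.nat_pow_mult add.commute)
  have auto_comm: "\<alpha> (\<beta> x) = \<beta> (\<alpha> x)" if "\<alpha> \<in> auto G" "\<beta> \<in> auto G" "x \<in> carrier G" for \<alpha> \<beta> x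
    using AutoGroup_apply(2)[OF that(3,1,2)] AutoGroup_apply(2)[OF that(3,2,1)] A_comm[OF that(1,2)]
    by simp
  \<comment> \<open>The crossed homomorphism law at the identity makes this power
    idempotent.\<close>
  have s_one [simp]: "x [^] s \<one>\<^bsub>?A\<^esub> = \<one>" if "x \<in> carrier G" for x
    using s_mult[of "\<one>\<^bsub>?A\<^esub>" "\<one>\<^bsub>?A\<^esub>" x] that by simp

  \<comment> \<open>The automorphism \<open>\<Phi> (b, \<beta>)\<close> extends
    \<open>\<beta>\<close> from \<open>G\<close> and, as \<open>s \<gamma>\<close> acts as exponent
    1, sends \<open>(\<one>, \<gamma>)\<close> to \<open>(b, \<gamma>)\<close>.\<close>
  define \<Phi> where "\<Phi> = (\<lambda>(b, \<beta>). \<lambda>(x, \<alpha>)\<in>carrier ?H. (\<beta> x \<otimes> b [^] s \<alpha>, \<alpha>))"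
  have \<Phi>_apply [simp]: "\<Phi> (b, \<beta>) (x, \<alpha>) = (\<beta> x \<otimes> b [^] s \<alpha>, \<alpha>)"
    if "x \<in> carrier G" "\<alpha> \<in> auto G" for b \<beta> x \<alpha>
    using that by (simp add: \<Phi>_def)
  have \<Phi>_auto [simp]: "\<Phi> (b, \<beta>) \<in> auto ?H" if b: "b \<in> carrier G" and \<beta>: "\<beta> \<in> auto G" for b \<beta>
  proof -
    have bij: "bij_betw (\<lambda>(x, \<alpha>). (\<beta> x \<otimes> b [^] s \<alpha>, \<alpha>)) (carrier ?H) (carrier ?H)"
      unfolding bij_betw_def
    proof
      show "inj_on (\<lambda>(x, \<alpha>). (\<beta> x \<otimes> b [^] s \<alpha>, \<alpha>)) (carrier ?H)"
        using b \<beta> auto_bij[OF \<beta>] by (auto simp: inj_on_def bij_betw_def)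
      show "(\<lambda>(x, \<alpha>). (\<beta> x \<otimes> b [^] s \<alpha>, \<alpha>)) ` carrier ?H = carrier ?H"
      proof
        show "carrier ?H \<subseteq> (\<lambda>(x, \<alpha>). (\<beta> x \<otimes> b [^] s \<alpha>, \<alpha>)) ` carrier ?H"
        proof
          fix z assume "z \<in> carrier ?H"
          then obtain y \<alpha> where z: "z = (y, \<alpha>)" "y \<in> carrier G" "\<alpha> \<in> auto G"
            by auto
          have "y \<otimes> inv (b [^] s \<alpha>) \<in> \<beta> ` carrier G"
            using auto_bij[OF \<beta>] z b by (simp add: bij_betw_def)
          then obtain x where x: "x \<in> carrier G" "\<beta> x = y \<otimes> inv (b [^] s \<alpha>)"
            by auto
          then have "(\<lambda>(x, \<alpha>). (\<beta> x \<otimes> b [^] s \<alpha>, \<alpha>)) (x, \<alpha>) = z"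
            using z b by (simp add: m_assoc)
          then show "z \<in> (\<lambda>(x, \<alpha>). (\<beta> x \<otimes> b [^] s \<alpha>, \<alpha>)) ` carrier ?H"
            using x(1) z(3) by force
        qed
      qed (use b \<beta> in auto)
    qed
    have "(\<lambda>(x, \<alpha>). (\<beta> x \<otimes> b [^] s \<alpha>, \<alpha>)) (u \<otimes>\<^bsub>?H\<^esub> v) =
        (\<lambda>(x, \<alpha>). (\<beta> x \<otimes> b [^] s \<alpha>, \<alpha>)) u \<otimes>\<^bsub>?H\<^esub> (\<lambda>(x, \<alpha>). (\<beta> x \<otimes> b [^] s \<alpha>, \<alpha>)) v"
      if "u \<in> carrier ?H" "v \<in> carrier ?H" for u v
    proof -
      obtain x \<alpha> y \<delta> where uv: "u = (x, \<alpha>)" "v = (y, \<delta>)"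
        and cl: "x \<in> carrier G" "\<alpha> \<in> auto G" "y \<in> carrier G" "\<delta> \<in> auto G"
        using \<open>u \<in> carrier ?H\<close> \<open>v \<in> carrier ?H\<close> by (cases u, cases v) simp
      \<comment> \<open>Both first components equal \<open>\<beta> x \<otimes> \<alpha> (\<beta> y)
        \<otimes> b [^] s \<alpha> \<otimes> \<alpha> (b [^] s \<delta>)\<close>: the left side by
        the crossed law and the commutation of \<open>\<alpha>\<close> with \<open>\<beta>\<close>,
        the right side by expanding \<open>\<alpha>\<close> of a product.\<close>
      show ?thesis
        using cl b \<beta> by (simp add: uv s_mult auto_mult auto_comm[of \<beta> \<alpha>] m_ac)
    qed
    from restrict_in_autoI[OF bij this H.is_group] show ?thesis
      unfolding \<Phi>_def by simp
  qed
  have "\<Phi> \<in> hom ?H (AutoGroup ?H)"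
  proof (rule homI)
    fix u v assume "u \<in> carrier ?H" "v \<in> carrier ?H"
    then obtain b \<beta> c \<delta> where uv: "u = (b, \<beta>)" "v = (c, \<delta>)"
      and cl: "b \<in> carrier G" "\<beta> \<in> auto G" "c \<in> carrier G" "\<delta> \<in> auto G"
      by auto
    \<comment> \<open>At \<open>(x, \<alpha>)\<close> this reduces to \<open>(b \<otimes> \<beta> c)
      [^] s \<alpha> = b [^] s \<alpha> \<otimes> \<beta> (c [^] s \<alpha>)\<close>, which holds
      because \<open>G\<close> is abelian.\<close>
    have "\<Phi> (u \<otimes>\<^bsub>?H\<^esub> v) = compose (carrier ?H) (\<Phi> u) (\<Phi> v)"
    proof (rule extensionalityI[of _ "carrier ?H"])
      show "\<Phi> (u \<otimes>\<^bsub>?H\<^esub> v) \<in> extensional (carrier ?H)"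
        by (simp add: \<Phi>_def uv)
      fix w assume "w \<in> carrier ?H"
      then show "\<Phi> (u \<otimes>\<^bsub>?H\<^esub> v) w = compose (carrier ?H) (\<Phi> u) (\<Phi> v) w"
        using cl by (auto simp: uv compose_eq auto_mult auto_pow nat_pow_distrib m_assoc m_comm[of "b [^] _"])
    qed (simp add: compose_def)
    then show "\<Phi> (u \<otimes>\<^bsub>?H\<^esub> v) = \<Phi> u \<otimes>\<^bsub>AutoGroup ?H\<^esub> \<Phi> v"
      using cl by (simp add: uv mult_AutoGroup)
  qed auto
  moreover have "inj_on \<Phi> (carrier ?H)"
  proof (rule inj_onI)
    fix u v assume "u \<in> carrier ?H" "v \<in> carrier ?H" and eq: "\<Phi> u = \<Phi> v"
    then obtain b \<beta> c \<delta> where uv: "u = (b, \<beta>)" "v = (c, \<delta>)"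
      and cl: "b \<in> carrier G" "\<beta> \<in> auto G" "c \<in> carrier G" "\<delta> \<in> auto G"
      by auto
    \<comment> \<open>Evaluation on \<open>G\<close> recovers the automorphism component, as the
      factor from \<open>s\<close> is trivial there; evaluation at \<open>(\<one>, \<gamma>)\<close>
      recovers \<open>b\<close>.\<close>
    have "\<beta> x = \<delta> x" if "x \<in> carrier G" for x
      using fun_cong[OF eq, of "(x, \<one>\<^bsub>?A\<^esub>)"] that cl by (simp add: uv)
    then have "\<beta> = \<delta>"
      using cl by (intro auto_eqI)
    moreover have "b = c"
      using fun_cong[OF eq, of "(\<one>, \<gamma>)"] cl \<gamma> by (simp add: uv s_\<gamma>)
    ultimately show "u = v"
      using uv by simp
  qed
  moreover have "\<exists>z\<in>carrier ?H. f = \<Phi> z" if f: "f \<in> auto ?H" for f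
  proof -
    define \<beta> where "\<beta> = (\<lambda>x\<in>carrier G. fst (f (x, \<one>\<^bsub>?A\<^esub>)))"
    obtain b \<delta> where f\<gamma>: "f (\<one>, \<gamma>) = (b, \<delta>)"
      by fastforce
    have f_cl: "f z \<in> carrier G \<times> auto G" if "z \<in> carrier G \<times> auto G" for z
      using auto_closed[OF f] that by simp
    have b: "b \<in> carrier G" and \<delta>: "\<delta> \<in> auto G"
      using f_cl[of "(\<one>, \<gamma>)"] f\<gamma> \<gamma> by auto
    have f_N: "f (x, \<one>\<^bsub>?A\<^esub>) = (\<beta> x, \<one>\<^bsub>?A\<^esub>)" if "x \<in> carrier G" for x
      using char[OF f that] that by (simp add: \<beta>_def prod_eq_iff)
    have \<beta>_cl: "\<beta> x \<in> carrier G" if "x \<in> carrier G" for x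
      using f_cl[of "(x, \<one>\<^bsub>?A\<^esub>)"] f_N[OF that] that by simp
    have \<beta>_mult: "\<beta> (x \<otimes> y) = \<beta> x \<otimes> \<beta> y" if "x \<in> carrier G" "y \<in> carrier G" for x y
      using auto_mult[OF f, of "(x, \<one>\<^bsub>?A\<^esub>)" "(y, \<one>\<^bsub>?A\<^esub>)"] that by (simp add: f_N \<beta>_cl)
    have "inj_on \<beta> (carrier G)"
    proof (rule inj_onI)
      fix x y assume "x \<in> carrier G" "y \<in> carrier G" "\<beta> x = \<beta> y"
      then show "x = y"
        using inj_onD[OF bij_betw_imp_inj_on[OF auto_bij[OF f]], of "(x, \<one>\<^bsub>?A\<^esub>)" "(y, \<one>\<^bsub>?A\<^esub>)"]
        by (simp add: f_N)
    qed
    \<comment> \<open>An injective self-map of a finite set is onto, so preservation of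
      \<open>G\<close> by the inverse of \<open>f\<close> need not be shown separately.\<close>
    then have bij: "bij_betw \<beta> (carrier G) (carrier G)"
      using \<beta>_cl fin by (simp add: bij_betw_def endo_inj_surj image_subsetI)
    have "restrict \<beta> (carrier G) = \<beta>"
      by (simp add: \<beta>_def)
    then have \<beta>: "\<beta> \<in> auto G"
      using restrict_in_autoI[OF bij \<beta>_mult is_group] by simp
    have "\<delta> y = \<gamma> y" if "y \<in> carrier G" for y
    proof -
      obtain x where x: "x \<in> carrier G" "y = \<beta> x"
        using bij \<open>y \<in> carrier G\<close> unfolding bij_betw_def by blast
      \<comment> \<open>Conjugation by \<open>\<gamma>\<close> acts on \<open>G\<close> as
        \<open>\<gamma>\<close> itself. Applying \<open>f\<close> and cancelling \<open>b\<close> in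
        the abelian group \<open>G\<close> gives \<open>\<delta> (\<beta> x) = \<beta> (\<gamma> x)
        = \<gamma> (\<beta> x)\<close>.\<close>
      have "f ((\<one>, \<gamma>) \<otimes>\<^bsub>?H\<^esub> (x, \<one>\<^bsub>?A\<^esub>)) = f ((\<gamma> x, \<one>\<^bsub>?A\<^esub>) \<otimes>\<^bsub>?H\<^esub> (\<one>, \<gamma>))"
        using x \<gamma> by simp
      then have "f (\<one>, \<gamma>) \<otimes>\<^bsub>?H\<^esub> f (x, \<one>\<^bsub>?A\<^esub>) = f (\<gamma> x, \<one>\<^bsub>?A\<^esub>) \<otimes>\<^bsub>?H\<^esub> f (\<one>, \<gamma>)"
        using x \<gamma> by (simp add: auto_mult[OF f] del: holomorph_simps(2))
      then have "b \<otimes> \<delta> (\<beta> x) = \<beta> (\<gamma> x) \<otimes> b"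
        using x \<gamma> b \<delta> \<beta> by (simp add: f_N f\<gamma>)
      then show ?thesis
        using x \<gamma> b \<delta> \<beta> by (simp add: m_comm[of _ b] auto_comm[of \<beta> \<gamma>])
    qed
    then have \<delta>_eq: "\<delta> = \<gamma>"
      using \<delta> \<gamma> by (intro auto_eqI)
    have \<Phi>f: "\<Phi> (b, \<beta>) \<in> auto ?H"
      using b \<beta> by simp
    \<comment> \<open>Both automorphisms agree at \<open>(\<one>, \<gamma>)\<close> and on
      \<open>G\<close>, and these generate the holomorph.\<close>
    have pow: "f (\<one>, \<gamma> [^]\<^bsub>?A\<^esub> k) = \<Phi> (b, \<beta>) (\<one>, \<gamma> [^]\<^bsub>?A\<^esub> k)" for k :: nat
    proof (induction k)
      case 0
      show ?case
        using f_N[of \<one>] b \<beta> by simp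
    next
      case (Suc k)
      have \<gamma>k: "\<gamma> [^]\<^bsub>?A\<^esub> k \<in> auto G"
        using A.nat_pow_closed[of \<gamma> k] \<gamma> by simp
      have split: "(\<one>, \<gamma> [^]\<^bsub>?A\<^esub> Suc k) = (\<one>, \<gamma> [^]\<^bsub>?A\<^esub> k) \<otimes>\<^bsub>?H\<^esub> (\<one>, \<gamma>)"
        using \<gamma> \<gamma>k by simp
      have "f (\<one>, \<gamma>) = \<Phi> (b, \<beta>) (\<one>, \<gamma>)"
        using f\<gamma> \<delta>_eq b \<beta> \<gamma> by (simp add: s_\<gamma>)
      then show ?case
        unfolding split using Suc \<gamma> \<gamma>k auto_mult[OF f] auto_mult[OF \<Phi>f]
        by (simp del: holomorph_simps(2) \<Phi>_apply)
    qed
    have "f w = \<Phi> (b, \<beta>) w" if "w \<in> carrier ?H" for w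
    proof -
      obtain x \<alpha> where w: "w = (x, \<alpha>)" "x \<in> carrier G" "\<alpha> \<in> auto G"
        using \<open>w \<in> carrier ?H\<close> by auto
      have split: "w = (x, \<one>\<^bsub>?A\<^esub>) \<otimes>\<^bsub>?H\<^esub> (\<one>, \<alpha>)"
        using w by simp
      have "f (x, \<one>\<^bsub>?A\<^esub>) = \<Phi> (b, \<beta>) (x, \<one>\<^bsub>?A\<^esub>)"
        using f_N w b \<beta> by simp
      moreover have "f (\<one>, \<alpha>) = \<Phi> (b, \<beta>) (\<one>, \<alpha>)"
        using pow gen[OF w(3)] by metis
      ultimately show ?thesis
        unfolding split using w(2,3) auto_mult[OF f] auto_mult[OF \<Phi>f]
        by (simp del: holomorph_simps(2) \<Phi>_apply)
    qed
    then have "f = \<Phi> (b, \<beta>)"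
      using auto_eqI[OF f \<Phi>f] by blast
    then show ?thesis
      using b \<beta> by auto
  qed
  ultimately have "\<Phi> \<in> iso ?H (AutoGroup ?H)"
    unfolding iso_def bij_betw_def by auto
  then show ?thesis
    unfolding is_iso_def by blast
qed

section \<open>Automorphisms of the holomorph preserve the base group\<close>

text \<open>Squares in \<open>G\<close> are mapped into \<open>G\<close> because inversion is an automorphism and the quotient by
  \<open>G\<close> is abelian; \<open>q\<close>-th powers because they are central in the holomorph, whose centre lies
  in \<open>G\<close>.\<close>

lemma (in comm_group) snd_auto_holomorph:
  fixes q :: nat
  assumes A_comm: "comm_group (AutoGroup G)"
    and q: "odd q"
    and fixed: "\<And>\<alpha> x. \<alpha> \<in> auto G \<Longrightarrow> x \<in> carrier G \<Longrightarrow> \<alpha> (x [^] q) = x [^] q"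
    and f: "f \<in> auto (holomorph G)"
    and x: "x \<in> carrier G"
  shows "snd (f (x, \<one>\<^bsub>AutoGroup G\<^esub>)) = \<one>\<^bsub>AutoGroup G\<^esub>"
proof -
  let ?A = "AutoGroup G" and ?H = "holomorph G"
  interpret A: comm_group ?A by (rule A_comm)
  interpret H: group ?H by (rule group_holomorph) (rule is_group)
  have one_auto [simp]: "\<one>\<^bsub>?A\<^esub> \<in> auto G"
    using A.one_closed by simp
  \<comment> \<open>Inclusion of \<open>G\<close>, then \<open>f\<close>, then projection to the
    automorphism group: a homomorphism that has to be shown trivial at \<open>x\<close>.\<close>
  define \<theta> where "\<theta> = (\<lambda>y. snd (f (y, \<one>\<^bsub>?A\<^esub>)))"
  have f_cl: "f z \<in> carrier G \<times> auto G" if "z \<in> carrier G \<times> auto G" for z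
    using auto_closed[OF f] that by simp
  have snd_f: "snd (f (u \<otimes>\<^bsub>?H\<^esub> v)) = snd (f u) \<otimes>\<^bsub>?A\<^esub> snd (f v)"
    if "u \<in> carrier ?H" "v \<in> carrier ?H" for u v
    using auto_mult[OF f that] by (cases "f u", cases "f v") simp
  have \<theta>_cl [simp]: "\<theta> y \<in> auto G" if "y \<in> carrier G" for y
    using f_cl[of "(y, \<one>\<^bsub>?A\<^esub>)"] that by (auto simp: \<theta>_def)
  have \<theta>_mult: "\<theta> (y \<otimes> z) = \<theta> y \<otimes>\<^bsub>?A\<^esub> \<theta> z" if "y \<in> carrier G" "z \<in> carrier G" for y z
    using snd_f[of "(y, \<one>\<^bsub>?A\<^esub>)" "(z, \<one>\<^bsub>?A\<^esub>)"] that A.r_one[of "\<one>\<^bsub>?A\<^esub>"] by (simp add: \<theta>_def)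
  have \<theta>_one: "\<theta> \<one> = \<one>\<^bsub>?A\<^esub>"
    using \<theta>_mult[of \<one> \<one>] A.l_cancel_one[of "\<theta> \<one>" "\<theta> \<one>"] by simp
  have \<theta>_square: "\<theta> (y \<otimes> y) = \<one>\<^bsub>?A\<^esub>" if y: "y \<in> carrier G" for y
  proof -
    define \<iota> where "\<iota> = restrict (m_inv G) (carrier G)"
    have "bij_betw (m_inv G) (carrier G) (carrier G)"
      by (rule bij_betw_byWitness[where f' = "m_inv G"]) auto
    then have \<iota>: "\<iota> \<in> auto G"
      unfolding \<iota>_def by (intro restrict_in_autoI) (auto simp: inv_mult is_group)
    \<comment> \<open>Conjugation by \<open>\<iota>\<close> inverts \<open>y\<close>; this becomes
      invisible in the abelian automorphism group, so
      \<open>\<theta> y = \<theta> (inv y)\<close>.\<close>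
    have "(\<one>, \<iota>) \<otimes>\<^bsub>?H\<^esub> (y, \<one>\<^bsub>?A\<^esub>) = (inv y, \<one>\<^bsub>?A\<^esub>) \<otimes>\<^bsub>?H\<^esub> (\<one>, \<iota>)"
      using y \<iota> by (simp add: \<iota>_def)
    then have "snd (f (\<one>, \<iota>)) \<otimes>\<^bsub>?A\<^esub> \<theta> y = \<theta> (inv y) \<otimes>\<^bsub>?A\<^esub> snd (f (\<one>, \<iota>))"
      using snd_f[of "(\<one>, \<iota>)" "(y, \<one>\<^bsub>?A\<^esub>)"] snd_f[of "(inv y, \<one>\<^bsub>?A\<^esub>)" "(\<one>, \<iota>)"] y \<iota>
      by (simp add: \<theta>_def)
    also have "\<dots> = snd (f (\<one>, \<iota>)) \<otimes>\<^bsub>?A\<^esub> \<theta> (inv y)"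
      using f_cl[of "(\<one>, \<iota>)"] y \<iota> by (intro A.m_comm) auto
    finally have "\<theta> y = \<theta> (inv y)"
      using f_cl[of "(\<one>, \<iota>)"] y \<iota> A.Units_l_cancel[of "snd (f (\<one>, \<iota>))" "\<theta> y" "\<theta> (inv y)"] by auto
    then have "\<theta> (y \<otimes> y) = \<theta> (y \<otimes> inv y)"
      using \<theta>_mult[OF y y] \<theta>_mult[OF y inv_closed[OF y]] by simp
    then show ?thesis
      using y \<theta>_one by simp
  qed
  have \<theta>_q: "\<theta> (x [^] q) = \<one>\<^bsub>?A\<^esub>"
  proof (rule auto_eqI)
    fix y assume y: "y \<in> carrier G"
    let ?z = "x [^] q"
    obtain d \<delta> where d: "f (?z, \<one>\<^bsub>?A\<^esub>) = (d, \<delta>)"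
      by fastforce
    have dcl: "d \<in> carrier G" "\<delta> \<in> auto G"
      using f_cl[of "(?z, \<one>\<^bsub>?A\<^esub>)"] d x by auto
    have "(y, \<one>\<^bsub>?A\<^esub>) \<in> f ` carrier ?H"
      using auto_bij[OF f] y by (simp add: bij_betw_def)
    then obtain a \<alpha> where a: "a \<in> carrier G" "\<alpha> \<in> auto G" "f (a, \<alpha>) = (y, \<one>\<^bsub>?A\<^esub>)"
      by auto
    have "(?z, \<one>\<^bsub>?A\<^esub>) \<otimes>\<^bsub>?H\<^esub> (a, \<alpha>) = (a, \<alpha>) \<otimes>\<^bsub>?H\<^esub> (?z, \<one>\<^bsub>?A\<^esub>)"
      using x a A.l_one[of \<alpha>] A.r_one[of \<alpha>] by (simp add: fixed[OF a(2) x] m_comm[of a])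
    then have "f (?z, \<one>\<^bsub>?A\<^esub>) \<otimes>\<^bsub>?H\<^esub> f (a, \<alpha>) = f (a, \<alpha>) \<otimes>\<^bsub>?H\<^esub> f (?z, \<one>\<^bsub>?A\<^esub>)"
      using auto_mult[OF f, of "(?z, \<one>\<^bsub>?A\<^esub>)" "(a, \<alpha>)"] auto_mult[OF f, of "(a, \<alpha>)" "(?z, \<one>\<^bsub>?A\<^esub>)"] x a(1,2)
      by (simp del: holomorph_simps(2))
    then have "d \<otimes> \<delta> y = y \<otimes> d"
      using dcl by (simp add: d a(3))
    then have "\<delta> y = y"
      using dcl y by (simp add: m_comm[of y])
    then show "\<theta> ?z y = \<one>\<^bsub>?A\<^esub> y"
      using y by (simp add: \<theta>_def d)
  qed (use x in auto)
  \<comment> \<open>As \<open>q\<close> is odd, \<open>x\<close> differs from its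
    \<open>q\<close>-th power by a square, and \<open>\<theta>\<close> is trivial on both.\<close>
  obtain j where j: "q = Suc (j + j)"
    using q by (metis oddE mult_2 Suc_eq_plus1)
  have "x [^] q = x \<otimes> (x [^] j \<otimes> x [^] j)"
    using x by (simp add: j nat_pow_mult m_comm)
  then have "\<theta> x \<otimes>\<^bsub>?A\<^esub> \<theta> (x [^] j \<otimes> x [^] j) = \<one>\<^bsub>?A\<^esub>"
    using \<theta>_q \<theta>_mult[of x "x [^] j \<otimes> x [^] j"] x by simp
  then have "\<theta> x = \<one>\<^bsub>?A\<^esub>"
    using \<theta>_square[of "x [^] j"] A.r_one[of "\<theta> x"] x by simp
  then show ?thesis
    by (simp add: \<theta>_def)
qed

section \<open>Finite cyclic groups and their power automorphisms\<close>

lemma (in group) pow_cong_order: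
  fixes k l :: nat
  assumes "x \<in> carrier G" "[k = l] (mod order G)"
  shows "x [^] k = x [^] l"
proof -
  have "x [^] m = x [^] (m mod order G)" for m :: nat
  proof -
    have "x [^] m = x [^] (order G * (m div order G) + m mod order G)"
      by simp
    also have "\<dots> = (x [^] order G) [^] (m div order G) \<otimes> x [^] (m mod order G)"
      using assms(1) by (simp only: nat_pow_mult nat_pow_pow nat_pow_closed)
    finally show ?thesis
      using assms(1) by (simp add: pow_order_eq_1)
  qed
  from this[of k] this[of l] assms(2) show ?thesis
    by (simp add: cong_def)
qed

text \<open>Integer exponents are reduced to their residues below the order. These residues map onto
  a set of the same finite size, hence injectively, so equal powers have congruent
  exponents.\<close>

lemma (in group) finite_cyclic_generator:
  assumes "cyclic_group G" "finite (carrier G)"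
  obtains c where "c \<in> carrier G" "\<And>x. x \<in> carrier G \<Longrightarrow> \<exists>k::nat. x = c [^] k"
    "\<And>k l :: nat. c [^] k = c [^] l \<Longrightarrow> [k = l] (mod order G)"
proof -
  obtain c where c: "c \<in> carrier G" "carrier G = range (\<lambda>i::int. c [^] i)"
    using assms(1) cyclic_group by auto
  have n: "order G > 0"
    using assms(2) by (simp add: order_gt_0_iff_finite)
  have image: "carrier G = (\<lambda>k::nat. c [^] k) ` {..<order G}"
  proof
    show "carrier G \<subseteq> (\<lambda>k::nat. c [^] k) ` {..<order G}"
    proof
      fix x assume "x \<in> carrier G"
      then obtain i :: int where x: "x = c [^] i"
        using c(2) by auto
      define r where "r = nat (i mod int (order G))"
      have r: "int r = i mod int (order G)" "r < order G"
        using n by (simp_all add: r_def nat_less_iff)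
      have "x = c [^] (int (order G) * (i div int (order G)) + int r)"
        by (simp add: x r)
      also have "\<dots> = (c [^] int (order G)) [^] (i div int (order G)) \<otimes> c [^] int r"
        using c(1) by (simp only: int_pow_mult int_pow_pow int_pow_closed)
      also have "\<dots> = c [^] r"
        using c(1) by (simp add: int_pow_int pow_order_eq_1)
      finally show "x \<in> (\<lambda>k::nat. c [^] k) ` {..<order G}"
        using r(2) by blast
    qed
  qed (use c(1) in auto)
  have "inj_on (\<lambda>k::nat. c [^] k) {..<order G}"
    using image by (intro eq_card_imp_inj_on) (simp_all add: order_def flip: image)
  then have "[k = l] (mod order G)" if "c [^] k = c [^] l" for k l :: nat
    using pow_cong_order[OF c(1), of k "k mod order G"] pow_cong_order[OF c(1), of l "l mod order G"]
      that n by (auto simp: inj_on_def cong_def)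
  moreover have "\<exists>k::nat. x = c [^] k" if "x \<in> carrier G" for x
    using that image by auto
  ultimately show thesis
    using that c(1) by blast
qed

text \<open>The inverse map is the power map for an inverse of \<open>m\<close> modulo the group
  order.\<close>

lemma (in comm_group) pow_in_auto:
  assumes "finite (carrier G)" "coprime m (order G)"
  shows "(\<lambda>x\<in>carrier G. x [^] m) \<in> auto G"
proof (rule restrict_in_autoI)
  obtain k where k: "[m * k = Suc 0] (mod order G)"
    using assms(2) coprime_iff_invertible_nat by blast
  have inverse: "(x [^] m) [^] k = x" "(x [^] k) [^] m = x" if "x \<in> carrier G" for x
    using pow_cong_order[OF that k] that by (simp_all add: nat_pow_pow mult.commute)
  show "bij_betw (\<lambda>x. x [^] m) (carrier G) (carrier G)"
    by (rule bij_betw_byWitness[where f' = "\<lambda>x. x [^] k"]) (auto simp: inverse)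
qed (auto simp: nat_pow_distrib is_group)

text \<open>The exponent is read off from the image of a generator \<open>c\<close>. It is a unit
  because \<open>c\<close> is itself a value of \<alpha>: if \<open>c = \<alpha> (c [^] k)\<close>,
  then \<open>m * k\<close> is 1 modulo the order.\<close>

lemma (in group) auto_cyclic_is_pow:
  assumes "cyclic_group G" "finite (carrier G)" "\<alpha> \<in> auto G"
  obtains m :: nat where "coprime m (order G)" "\<And>x. x \<in> carrier G \<Longrightarrow> \<alpha> x = x [^] m"
proof -
  obtain c where c: "c \<in> carrier G" "\<And>x. x \<in> carrier G \<Longrightarrow> \<exists>k::nat. x = c [^] k"
    "\<And>k l :: nat. c [^] k = c [^] l \<Longrightarrow> [k = l] (mod order G)"
    using finite_cyclic_generator[OF assms(1,2)] by blast
  obtain m :: nat where m: "\<alpha> c = c [^] m"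
    using c(2)[OF auto_closed[OF assms(3) c(1)]] by blast
  have pow: "\<alpha> x = x [^] m" if "x \<in> carrier G" for x
  proof -
    obtain k :: nat where "x = c [^] k"
      using c(2)[OF \<open>x \<in> carrier G\<close>] by blast
    then show ?thesis
      using group_hom.hom_nat_pow[OF auto_group_hom[OF assms(3)] c(1), of k] c(1)
      by (simp add: m nat_pow_pow mult.commute[of m])
  qed
  have "c \<in> \<alpha> ` carrier G"
    using auto_bij[OF assms(3)] c(1) by (simp add: bij_betw_def)
  then obtain y where y: "y \<in> carrier G" "c = \<alpha> y"
    by auto
  obtain k :: nat where "y = c [^] k"
    using c(2)[OF y(1)] by blast
  then have "c [^] (m * k) = y [^] m"
    using c(1) by (simp add: nat_pow_pow mult.commute)
  also have "\<dots> = c [^] Suc 0"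
    using y(2) pow[OF y(1)] c(1) by simp
  finally have "coprime m (order G)"
    using c(3) coprime_iff_invertible_nat by blast
  with pow show thesis
    using that by blast
qed

section \<open>The cyclic group of order 2 p^e\<close>

theorem theorem1p1:
  fixes p e :: nat and C :: "'a monoid"
  assumes "prime p" and "odd p" and "e > 0"
    and "group C" and "cyclic_group C" and "order C = 2 * p ^ e"
  shows "holomorph C \<cong> AutoGroup (holomorph C)"
proof -
  interpret group C by fact
  interpret comm_group C
    using cyclic_imp_abelian_group assms(5) by blast
  interpret A: group "AutoGroup C" by (rule AutoGroup)
  have fin: "finite (carrier C)"
    using assms(1,6) order_gt_0_iff_finite prime_gt_0_nat by fastforce
  obtain c where c: "c \<in> carrier C"
    and c_inj: "\<And>k l :: nat. c [^]\<^bsub>C\<^esub> k = c [^]\<^bsub>C\<^esub> l \<Longrightarrow> [k = l] (mod order C)"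
    using finite_cyclic_generator[OF assms(5) fin] by metis
  obtain g where g: "coprime g (order C)"
    and g_gen: "\<And>m. coprime m (order C) \<Longrightarrow> \<exists>k. [g ^ k = m] (mod order C)"
    and g_sum: "\<And>k l. [g ^ k = g ^ l] (mod order C) \<Longrightarrow>
      [(\<Sum>i<k. g ^ i) = (\<Sum>i<l. g ^ i)] (mod order C)"
    using primroot_geometric_sums[OF assms(1,2,3,6)] by metis
  define \<gamma> where "\<gamma> = (\<lambda>x\<in>carrier C. x [^]\<^bsub>C\<^esub> g)"
  have \<gamma>_apply: "\<gamma> x = x [^]\<^bsub>C\<^esub> g" if "x \<in> carrier C" for x
    using that by (simp add: \<gamma>_def)
  have \<gamma>: "\<gamma> \<in> auto C"
    unfolding \<gamma>_def using fin g by (rule pow_in_auto)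
  have \<gamma>_pow_auto: "\<gamma> [^]\<^bsub>AutoGroup C\<^esub> k \<in> auto C" for k :: nat
    using A.nat_pow_closed[of \<gamma> k] \<gamma> by simp
  have \<gamma>_pow: "(\<gamma> [^]\<^bsub>AutoGroup C\<^esub> k) x = x [^]\<^bsub>C\<^esub> (g ^ k)" if "x \<in> carrier C" for k :: nat and x
    using that
  proof (induction k arbitrary: x)
    case (Suc k)
    then show ?case
      using \<gamma> \<gamma>_pow_auto[of k] by (simp add: \<gamma>_apply nat_pow_pow)
  qed simp
  have gen: "\<exists>k::nat. \<alpha> = \<gamma> [^]\<^bsub>AutoGroup C\<^esub> k" if \<alpha>: "\<alpha> \<in> auto C" for \<alpha>
  proof -
    obtain m :: nat where m: "coprime m (order C)" "\<And>x. x \<in> carrier C \<Longrightarrow> \<alpha> x = x [^]\<^bsub>C\<^esub> m"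
      using auto_cyclic_is_pow[OF assms(5) fin \<alpha>] by blast
    obtain k where k: "[g ^ k = m] (mod order C)"
      using g_gen[OF m(1)] by blast
    have "\<alpha> = \<gamma> [^]\<^bsub>AutoGroup C\<^esub> k"
      using \<alpha> \<gamma>_pow_auto by (rule auto_eqI) (simp add: m(2) \<gamma>_pow pow_cong_order[OF _ k])
    then show ?thesis ..
  qed
  have A_comm: "comm_group (AutoGroup C)"
  proof (rule A.group_comm_groupI)
    fix \<alpha> \<beta> assume "\<alpha> \<in> carrier (AutoGroup C)" "\<beta> \<in> carrier (AutoGroup C)"
    then obtain k l :: nat where "\<alpha> = \<gamma> [^]\<^bsub>AutoGroup C\<^esub> k" "\<beta> = \<gamma> [^]\<^bsub>AutoGroup C\<^esub> l"
      using gen by fastforce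
    then show "\<alpha> \<otimes>\<^bsub>AutoGroup C\<^esub> \<beta> = \<beta> \<otimes>\<^bsub>AutoGroup C\<^esub> \<alpha>"
      using \<gamma> by (simp add: A.nat_pow_mult add.commute)
  qed
  \<comment> \<open>Any exponent representing \<alpha> may be chosen: only the class of the sum
    modulo the order matters, and that is independent of the choice.\<close>
  define s where "s \<alpha> = (\<Sum>i<(SOME k. \<alpha> = \<gamma> [^]\<^bsub>AutoGroup C\<^esub> k). g ^ i)" for \<alpha>
  have s_pow: "x [^]\<^bsub>C\<^esub> s (\<gamma> [^]\<^bsub>AutoGroup C\<^esub> k) = x [^]\<^bsub>C\<^esub> (\<Sum>i<k. g ^ i)"
    if "x \<in> carrier C" for k :: nat and x
  proof (rule pow_cong_order[OF that])
    define l where "l = (SOME l. \<gamma> [^]\<^bsub>AutoGroup C\<^esub> k = \<gamma> [^]\<^bsub>AutoGroup C\<^esub> (l::nat))"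
    have "\<gamma> [^]\<^bsub>AutoGroup C\<^esub> k = \<gamma> [^]\<^bsub>AutoGroup C\<^esub> l"
      unfolding l_def by (rule someI) (rule refl)
    \<comment> \<open>Evaluation at the generator turns equality of automorphisms into a congruence
      of powers of \<open>g\<close>.\<close>
    then have "c [^]\<^bsub>C\<^esub> (g ^ l) = c [^]\<^bsub>C\<^esub> (g ^ k)"
      using \<gamma>_pow[OF c] by metis
    then show "[s (\<gamma> [^]\<^bsub>AutoGroup C\<^esub> k) = (\<Sum>i<k. g ^ i)] (mod order C)"
      unfolding s_def l_def[symmetric] by (intro g_sum c_inj)
  qed
  show ?thesis
  proof (rule holomorph_iso_AutoGroup_holomorph)
    show "finite (carrier C)" by fact
    show "\<gamma> \<in> auto C" by fact
    show "\<exists>k::nat. \<alpha> = \<gamma> [^]\<^bsub>AutoGroup C\<^esub> k" if "\<alpha> \<in> auto C" for \<alpha>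
      using that by (rule gen)
    show "x [^]\<^bsub>C\<^esub> s \<gamma> = x" if "x \<in> carrier C" for x
      using s_pow[OF that, of 1] that \<gamma> by simp
  next
    fix \<alpha> \<beta> x assume \<alpha>: "\<alpha> \<in> auto C" and \<beta>: "\<beta> \<in> auto C" and x: "x \<in> carrier C"
    obtain k l :: nat where kl: "\<alpha> = \<gamma> [^]\<^bsub>AutoGroup C\<^esub> k" "\<beta> = \<gamma> [^]\<^bsub>AutoGroup C\<^esub> l"
      using gen[OF \<alpha>] gen[OF \<beta>] by blast
    \<comment> \<open>This is the crossed homomorphism law, since \<alpha> raises elements to the
      power \<open>g ^ k\<close>.\<close>
    have "(\<Sum>i<k + l. g ^ i) = (\<Sum>i<k. g ^ i) + (\<Sum>i<l. g ^ i) * g ^ k"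
      by (induction l) (auto simp: algebra_simps power_add)
    moreover have "\<alpha> \<otimes>\<^bsub>AutoGroup C\<^esub> \<beta> = \<gamma> [^]\<^bsub>AutoGroup C\<^esub> (k + l)"
      using \<gamma> by (simp add: kl A.nat_pow_mult)
    ultimately show "x [^]\<^bsub>C\<^esub> s (\<alpha> \<otimes>\<^bsub>AutoGroup C\<^esub> \<beta>) = x [^]\<^bsub>C\<^esub> s \<alpha> \<otimes>\<^bsub>C\<^esub> \<alpha> (x [^]\<^bsub>C\<^esub> s \<beta>)"
      using x by (simp add: kl s_pow \<gamma>_pow nat_pow_mult nat_pow_pow)
  next
    fix f x assume f: "f \<in> auto (holomorph C)" and x: "x \<in> carrier C"
    show "snd (f (x, \<one>\<^bsub>AutoGroup C\<^esub>)) = \<one>\<^bsub>AutoGroup C\<^esub>"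
    proof (rule snd_auto_holomorph[OF A_comm _ _ f x])
      show "odd (p ^ e)"
        using assms(2) by simp
      fix \<alpha> y assume \<alpha>: "\<alpha> \<in> auto C" and y: "y \<in> carrier C"
      obtain m :: nat where m: "coprime m (order C)" "\<And>x. x \<in> carrier C \<Longrightarrow> \<alpha> x = x [^]\<^bsub>C\<^esub> m"
        using auto_cyclic_is_pow[OF assms(5) fin \<alpha>] by blast
      have "odd m"
        using m(1) assms(6) by auto
      then obtain j where "m = 2 * j + 1"
        by (elim oddE)
      \<comment> \<open>For \<open>m = 2 * j + 1\<close> the difference is \<open>j\<close> times
        the order \<open>2 * p ^ e\<close>; hence \<open>p ^ e\<close>-th powers are fixed by all
        automorphisms.\<close>
      then have "[p ^ e * m = p ^ e] (mod order C)"
        by (simp add: assms(6) cong_def algebra_simps)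
      then show "\<alpha> (y [^]\<^bsub>C\<^esub> (p ^ e)) = y [^]\<^bsub>C\<^esub> (p ^ e)"
        using pow_cong_order[OF y] m(2) y by (simp add: nat_pow_pow)
    qed
  qed
qed

end
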